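(* For every $k\in\mathbb{N}$, $$3^{3k}=\sum_{p+q=k}\binom{3p}{p,p,p}\binom{3q}{q,q,q}+3\sum_{\substack{p+q+r=k-1\\ r'+q'=r+q+1\\ p''+r''=p+r+1}}\binom{2p+p''}{p,p,p''}\binom{2q+q'}{q,q,q'}\binom{r+r'+r''}{r,r',r''},$$ where the first sum runs over all pairs $(p,q)$ of nonnegative integers with $p+q=k$, and the second sum runs over all tuples $(p,q,r,q',r',p'',r'')$ of nonnegative integers satisfying the three displayed conditions.
   Context: $\mathbb{N}$ denotes the positive integers. For nonnegative integers $a_1,\dots,a_l$ with $N=a_1+\cdots+a_l$, the multinomial coefficient is $\binom{N}{a_1,\dots,a_l}=\frac{N!}{a_1!\cdots a_l!}$. Primed symbols such as $p''$, $q'$ are independent integer summation variables (not derivatives). *)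

theory Defs
  imports Main
begin

(* The upper entry N of the multinomial coefficient is determined as the sum of the lower ones. *)
definition multinomial :: "nat list \<Rightarrow> nat"
  where "multinomial as = fact (sum_list as) div prod_list (map fact as)"

(* The division in the definition above is exact. *)
lemma prod_fact_dvd_fact_sum_list:
  "prod_list (map fact as) dvd (fact (sum_list as) :: nat)"
proof (induction as)
  case Nil
  then show ?case by simp
next
  case (Cons a as)
  have "fact a * prod_list (map fact as) dvd fact a * (fact (sum_list as) :: nat)"
    using Cons.IH by (rule mult_dvd_mono[OF dvd_refl])
  also have "\<dots> dvd fact (a + sum_list as)"
    by (rule fact_fact_dvd_fact)
  finally show ?case by simp
qed

end

theory Submission
  imports Defs "HOL-Computational_Algebra.Formal_Power_Series"
begin

text \<open>
  Think of \<open>trinomial i j l\<close> as the number of words with \<open>i\<close> letters \<open>a\<close>, \<open>j\<close> letters \<open>b\<close> and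
  \<open>l\<close> letters \<open>c\<close>. Let \<open>G\<close> be the generating function of triples of words \<open>(w1, w2, w3)\<close> in which
  \<open>w1\<close> has as many \<open>a\<close> as \<open>b\<close>, \<open>w2\<close> has as many \<open>a\<close> as \<open>c\<close>, and \<open>w3\<close> is arbitrary. The three factors
  of \<open>G\<close> are algebraic:
  \<open>G = 1 / (D * sqrt L1 * sqrt L2)\<close> with \<open>D = 1 - a - b - c\<close>, \<open>L1 = (1 - c)^2 - 4 a b\<close> and
  \<open>L2 = (1 - b)^2 - 4 a c\<close> (the constants \<open>triples\<close>, \<open>letters_den\<close>, \<open>ab_disc\<close>, \<open>ac_disc\<close>). Write \<open>diag f k\<close> for the coefficient of \<open>(a b c)^k\<close> in \<open>f\<close>. Sorting by
  the composition of the words shows that the first sum of the theorem is \<open>diag (D * G) k\<close> and the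
  second one is \<open>diag (a * G) k\<close>. Since \<open>1 = D + a + b + c\<close>, the theorem follows from two facts:
  \<open>diag G k = 27 ^ k\<close> and \<open>diag ((b + c - 2 a) * G) k = 0\<close>; the latter turns the contributions of
  \<open>a\<close>, \<open>b\<close> and \<open>c\<close> together into three times that of \<open>a\<close>.

  Both facts come from integration by parts. The Euler operators \<open>a d/da\<close>, \<open>b d/db\<close>, \<open>c d/dc\<close> all act on
  diagonal coefficients as multiplication by \<open>k\<close>. If the polynomial vector field
  \<open>P a d/da + Q b d/db + R c d/dc\<close> is tangent to the surfaces \<open>D = 0\<close>, \<open>L1 = 0\<close> and \<open>L2 = 0\<close>, then it
  maps \<open>G\<close> to a polynomial multiple of \<open>G\<close>. Its divergence, the sum of the Euler derivatives of
  \<open>P * G\<close>, \<open>Q * G\<close>, \<open>R * G\<close>, is then also a polynomial multiple \<open>S * G\<close>, and taking diagonals gives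
  \<open>k * diag ((P + Q + R) * G) k = diag (S * G) k\<close> (lemma \<open>diag_recurrence\<close>).

  Three such fields suffice. With \<open>x = diag ((b + c - 2 a) * G)\<close> and
  \<open>y = diag ((b + c - 2 (a b + a c + b c)) * G)\<close> they give
  \<open>k (3 y(k) - x(k)) = - y(k)\<close>,
  \<open>k (2 y(k) - 18 x(k-1)) = - y(k) - 6 x(k-1)\<close> and
  \<open>k (2 diag G k - 54 diag G (k-1)) = - y(k)\<close>.
  The first two form a homogeneous recurrence that starts from \<open>x(0) = 0\<close>, so \<open>x\<close> vanishes, and
  so does \<open>y\<close> at positive indices; the third then says that \<open>diag G\<close> is geometric with ratio \<open>27\<close>.
\<close>

unbundle fps_syntax

section \<open>Derivations and Euler operators\<close>

definition derivation :: "('r::comm_ring_1 \<Rightarrow> 'r) \<Rightarrow> bool" where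
  "derivation d \<longleftrightarrow> (\<forall>x y. d (x + y) = d x + d y) \<and> (\<forall>x y. d (x * y) = d x * y + x * d y)"

lemma derivationI:
  assumes "\<And>x y. d (x + y) = d x + d y" "\<And>x y. d (x * y) = d x * y + x * d y"
  shows "derivation d"
  using assms by (simp add: derivation_def)

lemma
  assumes "derivation d"
  shows derivation_add: "d (x + y) = d x + d y"
    and derivation_mult: "d (x * y) = d x * y + x * d y"
    and derivation_0: "d 0 = 0"
    and derivation_1: "d 1 = 0"
    and derivation_minus: "d (- x) = - d x"
    and derivation_diff: "d (x - y) = d x - d y"
proof -
  show add: "d (x + y) = d x + d y" for x y using assms by (simp add: derivation_def)
  show mult: "d (x * y) = d x * y + x * d y" for x y using assms by (simp add: derivation_def)
  show zero: "d 0 = 0" using add[of 0 0] by simp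
  show "d 1 = 0" using mult[of 1 1] by simp
  show minus: "d (- x) = - d x" for x using add[of x "- x"] zero by (simp add: eq_neg_iff_add_eq_0 add.commute)
  show "d (x - y) = d x - d y" using add[of x "- y"] minus[of y] by simp
qed

lemma derivation_numeral:
  assumes "derivation d"
  shows "d (numeral n) = 0"
proof -
  have "d (of_nat k) = 0" for k
    by (induction k) (simp_all add: derivation_0[OF assms] derivation_1[OF assms] derivation_add[OF assms])
  from this[of "numeral n"] show ?thesis by simp
qed

lemma derivation_sum:
  assumes "derivation d"
  shows "d (sum f A) = (\<Sum>x\<in>A. d (f x))"
  by (induction A rule: infinite_finite_induct)
    (simp_all add: derivation_0[OF assms] derivation_add[OF assms])

lemma derivation_power2:
  assumes "derivation d"
  shows "d (x ^ 2) = 2 * x * d x"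
  by (simp add: power2_eq_square derivation_mult[OF assms] algebra_simps)

lemmas derivation_simps = derivation_add derivation_mult derivation_0 derivation_1
  derivation_minus derivation_diff derivation_numeral derivation_power2

lemma derivation_combination:
  assumes "derivation d1" "derivation d2" "derivation d3"
  shows "derivation (\<lambda>x. p * d1 x + q * d2 x + r * d3 x)"
  by (rule derivationI)
    (simp_all add: derivation_add[OF assms(1)] derivation_add[OF assms(2)] derivation_add[OF assms(3)]
      derivation_mult[OF assms(1)] derivation_mult[OF assms(2)] derivation_mult[OF assms(3)] algebra_simps)

definition fps_euler :: "'r::comm_ring_1 fps \<Rightarrow> 'r fps" where
  "fps_euler f = fps_X * fps_deriv f"

lemma fps_euler_nth: "fps_euler f $ n = of_nat n * f $ n"
  by (cases n) (simp_all add: fps_euler_def)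

lemma derivation_fps_euler: "derivation fps_euler"
  by (rule derivationI) (simp_all add: fps_euler_def algebra_simps)

text \<open>
  Series in several variables are iterated univariate series; an operator in an inner variable acts
  on each coefficient with respect to the outer one.
\<close>
definition fps_coeffwise :: "('r \<Rightarrow> 'r) \<Rightarrow> 'r fps \<Rightarrow> 'r fps" where
  "fps_coeffwise d f = Abs_fps (\<lambda>n. d (f $ n))"

lemma fps_coeffwise_nth [simp]: "fps_coeffwise d f $ n = d (f $ n)"
  by (simp add: fps_coeffwise_def)

lemma derivation_fps_coeffwise:
  assumes "derivation d"
  shows "derivation (fps_coeffwise d)"
proof (rule derivationI)
  show "fps_coeffwise d (f + g) = fps_coeffwise d f + fps_coeffwise d g" for f g
    by (rule fps_ext) (simp add: derivation_add[OF assms])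
  show "fps_coeffwise d (f * g) = fps_coeffwise d f * g + f * fps_coeffwise d g" for f g
    by (rule fps_ext)
      (simp add: fps_mult_nth derivation_sum[OF assms] derivation_mult[OF assms] sum.distrib)
qed

section \<open>Power series in three variables\<close>

type_synonym series3 = "rat fps fps fps"

definition va :: series3 where "va = fps_X"
definition vb :: series3 where "vb = fps_const fps_X"
definition vc :: series3 where "vc = fps_const (fps_const fps_X)"

definition euler_a :: "series3 \<Rightarrow> series3" where "euler_a = fps_euler"
definition euler_b :: "series3 \<Rightarrow> series3" where "euler_b = fps_coeffwise fps_euler"
definition euler_c :: "series3 \<Rightarrow> series3" where "euler_c = fps_coeffwise (fps_coeffwise fps_euler)"

lemma derivation_euler_a: "derivation euler_a"
  and derivation_euler_b: "derivation euler_b"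
  and derivation_euler_c: "derivation euler_c"
  unfolding euler_a_def euler_b_def euler_c_def
  by (intro derivation_fps_euler derivation_fps_coeffwise)+

lemma fps3_eqI:
  fixes f g :: series3
  assumes "\<And>i j l. f $ i $ j $ l = g $ i $ j $ l"
  shows "f = g"
  using assms by (intro fps_ext)

lemma fps3_nth:
  fixes f :: series3
  shows "(va * f) $ i $ j $ l = (if i = 0 then 0 else f $ (i - 1) $ j $ l)"
    and "(vb * f) $ i $ j $ l = (if j = 0 then 0 else f $ i $ (j - 1) $ l)"
    and "(vc * f) $ i $ j $ l = (if l = 0 then 0 else f $ i $ j $ (l - 1))"
    and "euler_a f $ i $ j $ l = of_nat i * f $ i $ j $ l"
    and "euler_b f $ i $ j $ l = of_nat j * f $ i $ j $ l"
    and "euler_c f $ i $ j $ l = of_nat l * f $ i $ j $ l"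
  by (simp_all add: va_def vb_def vc_def euler_a_def euler_b_def euler_c_def fps_euler_nth fps_mult_left_const_nth
     flip: fps_of_nat)

lemma fps3_numeral_nth: "(numeral n * f) $ i $ j $ l = numeral n * (f :: series3) $ i $ j $ l"
  by (simp add: numeral_fps_const)

lemma fps3_mult_nth:
  fixes f g :: series3
  shows "(f * g) $ i $ j $ l =
    (\<Sum>i'\<le>i. \<Sum>j'\<le>j. \<Sum>l'\<le>l. f $ i' $ j' $ l' * g $ (i - i') $ (j - j') $ (l - l'))"
  by (simp add: fps_mult_nth fps_sum_nth atLeast0AtMost)

lemma euler_variables:
  "euler_a va = va" "euler_a vb = 0" "euler_a vc = 0"
  "euler_b va = 0" "euler_b vb = vb" "euler_b vc = 0"
  "euler_c va = 0" "euler_c vb = 0" "euler_c vc = vc"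
  unfolding va_def vb_def vc_def euler_a_def euler_b_def euler_c_def
  by (simp_all add: fps_eq_iff fps_euler_nth fps_X_def)

lemmas euler_simps = derivation_simps[OF derivation_euler_a] derivation_simps[OF derivation_euler_b]
  derivation_simps[OF derivation_euler_c] euler_variables

section \<open>Generating functions of words\<close>

definition series_of :: "(nat \<Rightarrow> nat \<Rightarrow> nat \<Rightarrow> rat) \<Rightarrow> series3" where
  "series_of f = Abs_fps (\<lambda>i. Abs_fps (\<lambda>j. Abs_fps (\<lambda>l. f i j l)))"

lemma series_of_nth [simp]: "series_of f $ i $ j $ l = f i j l"
  by (simp add: series_of_def)

definition trinomial :: "nat \<Rightarrow> nat \<Rightarrow> nat \<Rightarrow> rat" where
  "trinomial i j l = fact (i + j + l) / (fact i * fact j * fact l)"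

lemma of_nat_multinomial_eq_trinomial: "of_nat (multinomial [i, j, l]) = trinomial i j l"
proof -
  have "(fact i * (fact j * fact l) :: nat) dvd fact (i + (j + l))"
    using prod_fact_dvd_fact_sum_list[of "[i, j, l]"] by simp
  then have "rat_of_nat (fact (i + (j + l)) div (fact i * (fact j * fact l))) =
      fact (i + (j + l)) / (fact i * (fact j * fact l))"
    by (simp add: of_nat_of_nat_div)
  then show ?thesis
    by (simp add: multinomial_def trinomial_def add.assoc mult.assoc)
qed

definition words :: series3 where "words = series_of trinomial"
definition ab_words :: series3 where "ab_words = series_of (\<lambda>i j l. if i = j then trinomial i i l else 0)"
definition ac_words :: series3 where "ac_words = series_of (\<lambda>i j l. if i = l then trinomial i i j else 0)"

text \<open>
  The polynomials that govern these series: \<open>words = 1 / letters_den\<close>, and \<open>ab_words\<close>, as the part of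
  \<open>1 / (1 - c - a u - b / u)\<close> that is constant in \<open>u\<close>, is the inverse square root of the discriminant
  \<open>ab_disc\<close> of \<open>a u^2 - (1 - c) u + b\<close>; symmetrically for \<open>ac_disc\<close>. The square
  roots enter through the differential equations \<open>inverse_square_root_derivative\<close>, which are linear
  in the coefficients of the series.
\<close>
definition letters_den where "letters_den = 1 - va - vb - vc"
definition ab_disc where "ab_disc = (1 - vc)^2 - 4 * va * vb"
definition ac_disc where "ac_disc = (1 - vb)^2 - 4 * va * vc"

lemma trinomial_Suc:
  "of_nat (Suc i) * trinomial (Suc i) j l = of_nat (Suc (i + j + l)) * trinomial i j l"
  "of_nat (Suc j) * trinomial i (Suc j) l = of_nat (Suc (i + j + l)) * trinomial i j l"
  "of_nat (Suc l) * trinomial i j (Suc l) = of_nat (Suc (i + j + l)) * trinomial i j l"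
  by (simp_all add: trinomial_def field_simps del: of_nat_Suc)

text \<open>
  Each term on the right is the fraction \<open>i / N\<close>, \<open>j / N\<close> or \<open>l / N\<close> of the left side, where
  \<open>N = i + j + l\<close>; this treats the boundary cases uniformly.
\<close>
lemma trinomial_pascal:
  assumes "i + j + l > 0"
  shows "trinomial i j l = (if i = 0 then 0 else trinomial (i - 1) j l)
     + (if j = 0 then 0 else trinomial i (j - 1) l) + (if l = 0 then 0 else trinomial i j (l - 1))"
proof -
  let ?N = "of_nat (i + j + l) :: rat"
  have a: "of_nat i * trinomial i j l = ?N * (if i = 0 then 0 else trinomial (i - 1) j l)"
    using trinomial_Suc(1)[of "i - 1" j l] by (cases i) simp_all
  have b: "of_nat j * trinomial i j l = ?N * (if j = 0 then 0 else trinomial i (j - 1) l)"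
    using trinomial_Suc(2)[of "j - 1" i l] by (cases j) simp_all
  have c: "of_nat l * trinomial i j l = ?N * (if l = 0 then 0 else trinomial i j (l - 1))"
    using trinomial_Suc(3)[of "l - 1" i j] by (cases l) simp_all
  have "?N * trinomial i j l = of_nat i * trinomial i j l + of_nat j * trinomial i j l + of_nat l * trinomial i j l"
    by (simp add: algebra_simps)
  also have "\<dots> = ?N * ((if i = 0 then 0 else trinomial (i - 1) j l)
     + (if j = 0 then 0 else trinomial i (j - 1) l) + (if l = 0 then 0 else trinomial i j (l - 1)))"
    unfolding a b c by (simp only: distrib_left)
  finally show ?thesis using assms by (simp only: mult_cancel_left of_nat_eq_0_iff) auto
qed

lemma letters_den_words: "letters_den * words = 1"
proof (rule fps3_eqI)
  fix i j l
  have "(letters_den * words) $ i $ j $ l = trinomial i j l - ((if i = 0 then 0 else trinomial (i - 1) j l)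
     + (if j = 0 then 0 else trinomial i (j - 1) l) + (if l = 0 then 0 else trinomial i j (l - 1)))"
    by (simp add: letters_den_def words_def left_diff_distrib fps3_nth)
  also have "\<dots> = (if i + j + l = 0 then 1 else 0)"
    using trinomial_pascal[of i j l] by (simp add: trinomial_def)
  finally show "(letters_den * words) $ i $ j $ l = 1 $ i $ j $ l"
    by simp
qed

lemma nat_01_cases [case_names 0 1 SS]:
  fixes n :: nat
  obtains "n = 0" | "n = Suc 0" | m where "n = Suc (Suc m)"
  by (metis not0_implies_Suc)

lemma trinomial_diagonal_recurrence_Suc:
  "of_nat (Suc p) * (trinomial (Suc p) (Suc p) (Suc (Suc n)) - 2 * trinomial (Suc p) (Suc p) (Suc n)
     + trinomial (Suc p) (Suc p) n)
   = of_nat (4 * p + 2) * trinomial p p (Suc (Suc n))"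
  by (simp add: trinomial_def divide_simps) (simp add: algebra_simps)

lemma trinomial_diagonal_recurrence_start:
  "of_nat (Suc p) * (trinomial (Suc p) (Suc p) (Suc 0) - 2 * trinomial (Suc p) (Suc p) 0)
   = of_nat (4 * p + 2) * trinomial p p (Suc 0)"
  "of_nat (Suc p) * (trinomial (Suc p) (Suc p) 0) = of_nat (4 * p + 2) * trinomial p p 0"
  by (simp_all add: trinomial_def divide_simps) (simp_all add: algebra_simps)

text \<open>The coefficients of \<open>ab_disc * euler_a ab_words = 2 a b * ab_words\<close>.\<close>
lemma trinomial_diagonal_recurrence:
  assumes "p > 0"
  shows "of_nat p * (trinomial p p n - (if n < 1 then 0 else 2 * trinomial p p (n - 1))
     + (if n < 2 then 0 else trinomial p p (n - 2)))
   = of_nat (4 * p - 2) * trinomial (p - 1) (p - 1) n"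
proof -
  obtain p' where p': "p = Suc p'" using assms by (cases p) auto
  show ?thesis
    by (cases n rule: nat_01_cases)
      (use trinomial_diagonal_recurrence_Suc trinomial_diagonal_recurrence_start p' in \<open>simp_all del: of_nat_Suc\<close>)
qed

lemma ab_disc_euler_a: "ab_disc * euler_a ab_words = 2 * va * vb * ab_words"
proof (rule fps3_eqI)
  fix i j l
  have *: "ab_disc * euler_a ab_words = euler_a ab_words - 2 * (vc * euler_a ab_words) + vc * (vc * euler_a ab_words)
      - 4 * (va * (vb * euler_a ab_words))"
    "2 * va * vb * ab_words = 2 * (va * (vb * ab_words))"
    unfolding ab_disc_def by algebra+
  show "(ab_disc * euler_a ab_words) $ i $ j $ l = (2 * va * vb * ab_words) $ i $ j $ l"
  proof (cases "i = j \<and> i > 0")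
    case True
    then have "j = i" "i > 0" by simp_all
    then show ?thesis unfolding *
      using trinomial_diagonal_recurrence[of i l]
      by (cases l rule: nat_01_cases)
        (simp_all add: fps3_nth fps3_numeral_nth ab_words_def algebra_simps of_nat_diff del: fps_mult_nth_0)
  next
    case False
    then show ?thesis unfolding *
      by (auto simp add: fps3_nth fps3_numeral_nth ab_words_def simp del: fps_mult_nth_0)
  qed
qed

lemma ac_disc_euler_a: "ac_disc * euler_a ac_words = 2 * va * vc * ac_words"
proof (rule fps3_eqI)
  fix i j l
  have *: "ac_disc * euler_a ac_words = euler_a ac_words - 2 * (vb * euler_a ac_words) + vb * (vb * euler_a ac_words)
      - 4 * (va * (vc * euler_a ac_words))"
    "2 * va * vc * ac_words = 2 * (va * (vc * ac_words))"
    unfolding ac_disc_def by algebra+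
  show "(ac_disc * euler_a ac_words) $ i $ j $ l = (2 * va * vc * ac_words) $ i $ j $ l"
  proof (cases "i = l \<and> i > 0")
    case True
    then have "l = i" "i > 0" by simp_all
    then show ?thesis unfolding *
      using trinomial_diagonal_recurrence[of i j]
      by (cases j rule: nat_01_cases)
        (simp_all add: fps3_nth fps3_numeral_nth ac_words_def algebra_simps of_nat_diff del: fps_mult_nth_0)
  next
    case False
    then show ?thesis unfolding *
      by (auto simp add: fps3_nth fps3_numeral_nth ac_words_def simp del: fps_mult_nth_0)
  qed
qed

lemma euler_b_ab_words: "euler_b ab_words = euler_a ab_words"
  by (rule fps3_eqI) (simp add: fps3_nth ab_words_def)

lemma euler_c_ac_words: "euler_c ac_words = euler_a ac_words"
  by (rule fps3_eqI) (simp add: fps3_nth ac_words_def)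

lemma euler_c_ab_words: "euler_c ab_words = vc * (2 * euler_a ab_words + euler_c ab_words + ab_words)"
proof (rule fps3_eqI)
  fix i j l
  show "euler_c ab_words $ i $ j $ l = (vc * (2 * euler_a ab_words + euler_c ab_words + ab_words)) $ i $ j $ l"
    using trinomial_Suc(3)[of "l - 1" i i]
    by (cases l; cases "i = j") (simp_all add: fps3_nth fps3_numeral_nth ab_words_def algebra_simps del: fps_mult_nth_0)
qed

lemma euler_b_ac_words: "euler_b ac_words = vb * (2 * euler_a ac_words + euler_b ac_words + ac_words)"
proof (rule fps3_eqI)
  fix i j l
  show "euler_b ac_words $ i $ j $ l = (vb * (2 * euler_a ac_words + euler_b ac_words + ac_words)) $ i $ j $ l"
    using trinomial_Suc(3)[of "j - 1" i i]
    by (cases j; cases "i = l") (simp_all add: fps3_nth fps3_numeral_nth ac_words_def algebra_simps del: fps_mult_nth_0)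
qed

lemma nonzero_factors: "1 - vc \<noteq> 0" "1 - vb \<noteq> 0" "letters_den \<noteq> 0" "ab_disc \<noteq> 0" "ac_disc \<noteq> 0"
proof -
  have [simp]: "va $ 0 = 0" "vb $ 0 $ 0 = 0" "vc $ 0 $ 0 $ 0 = 0"
    by (simp_all add: va_def vb_def vc_def)
  have "(1 - vc) $ 0 $ 0 $ 0 = 1" "(1 - vb) $ 0 $ 0 $ 0 = 1"
    "letters_den $ 0 $ 0 $ 0 = 1" "ab_disc $ 0 $ 0 $ 0 = 1" "ac_disc $ 0 $ 0 $ 0 = 1"
    by (simp_all add: letters_den_def ab_disc_def ac_disc_def power2_eq_square fps_mult_nth_0)
  then show "1 - vc \<noteq> 0" "1 - vb \<noteq> 0" "letters_den \<noteq> 0" "ab_disc \<noteq> 0" "ac_disc \<noteq> 0"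
    by (metis fps_zero_nth zero_neq_one)+
qed

text \<open>
  The operator relation of lemma \<open>euler_c_ab_words\<close> expresses \<open>(1 - c) * euler_c ab_words\<close> by
  \<open>euler_a ab_words\<close>, so the equation for \<open>euler_c\<close> follows from the one for \<open>euler_a\<close> after
  cancelling \<open>1 - c\<close>.
\<close>
lemma ab_disc_euler_c: "ab_disc * euler_c ab_words = vc * (1 - vc) * ab_words"
proof -
  have "(1 - vc) * (ab_disc * euler_c ab_words) = vc * (2 * (ab_disc * euler_a ab_words) + ab_disc * ab_words)"
    using euler_c_ab_words by algebra
  also have "\<dots> = (1 - vc) * (vc * (1 - vc) * ab_words)"
    unfolding ab_disc_euler_a unfolding ab_disc_def by algebra
  finally show ?thesis using nonzero_factors by simp
qed

lemma ac_disc_euler_b: "ac_disc * euler_b ac_words = vb * (1 - vb) * ac_words"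
proof -
  have "(1 - vb) * (ac_disc * euler_b ac_words) = vb * (2 * (ac_disc * euler_a ac_words) + ac_disc * ac_words)"
    using euler_b_ac_words by algebra
  also have "\<dots> = (1 - vb) * (vb * (1 - vb) * ac_words)"
    unfolding ac_disc_euler_a unfolding ac_disc_def by algebra
  finally show ?thesis using nonzero_factors by simp
qed

lemma inverse_square_root_derivative:
  "2 * ab_disc * euler_a ab_words = - euler_a ab_disc * ab_words"
  "2 * ab_disc * euler_b ab_words = - euler_b ab_disc * ab_words"
  "2 * ab_disc * euler_c ab_words = - euler_c ab_disc * ab_words"
  "2 * ac_disc * euler_a ac_words = - euler_a ac_disc * ac_words"
  "2 * ac_disc * euler_b ac_words = - euler_b ac_disc * ac_words"
  "2 * ac_disc * euler_c ac_words = - euler_c ac_disc * ac_words"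
  unfolding mult.assoc[of 2] euler_b_ab_words euler_c_ac_words
    ab_disc_euler_a ab_disc_euler_c ac_disc_euler_a ac_disc_euler_b
  by (simp_all add: ab_disc_def ac_disc_def euler_simps algebra_simps)

section \<open>Tangent vector fields and diagonal coefficients\<close>

definition triples where "triples = ab_words * ac_words * words"

text \<open>
  The hypotheses say that the derivation \<open>v = P * euler_a + Q * euler_b + R * euler_c\<close> is tangent to
  the zero sets of the three polynomials. Being a logarithmic derivative, \<open>v f / f\<close> turns the product
  \<open>triples\<close> into a sum: the exponents \<open>-1\<close>, \<open>-1/2\<close>, \<open>-1/2\<close> of the polynomials contribute
  \<open>- \<alpha>\<close>, \<open>- \<beta>\<close>, \<open>- \<gamma>\<close>, the last two because of the factor \<open>2\<close> in the hypotheses.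
\<close>
lemma tangent_field_divergence:
  assumes "P * euler_a letters_den + Q * euler_b letters_den + R * euler_c letters_den = \<alpha> * letters_den"
  and "P * euler_a ab_disc + Q * euler_b ab_disc + R * euler_c ab_disc = 2 * \<beta> * ab_disc"
  and "P * euler_a ac_disc + Q * euler_b ac_disc + R * euler_c ac_disc = 2 * \<gamma> * ac_disc"
  shows "euler_a (P * triples) + euler_b (Q * triples) + euler_c (R * triples) =
    (euler_a P + euler_b Q + euler_c R - \<alpha> - \<beta> - \<gamma>) * triples"
proof -
  define v where "v x = P * euler_a x + Q * euler_b x + R * euler_c x" for x
  have der: "derivation v"
    unfolding v_def by (intro derivation_combination derivation_euler_a derivation_euler_b derivation_euler_c)
  have "letters_den * (v words + \<alpha> * words) = 0"
    using derivation_mult[OF der, of letters_den words] assms(1)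
    unfolding letters_den_words derivation_1[OF der] v_def[of letters_den] by algebra
  then have 1: "v words = - \<alpha> * words" using nonzero_factors by (simp add: eq_neg_iff_add_eq_0)
  have "2 * ab_disc * v ab_words = - (P * euler_a ab_disc + Q * euler_b ab_disc + R * euler_c ab_disc) * ab_words"
    unfolding v_def using inverse_square_root_derivative(1-3) by algebra
  then have "2 * ab_disc * (v ab_words + \<beta> * ab_words) = 0"
    unfolding assms(2) by (simp add: algebra_simps)
  then have 2: "v ab_words = - \<beta> * ab_words" using nonzero_factors by (simp add: eq_neg_iff_add_eq_0)
  have "2 * ac_disc * v ac_words = - (P * euler_a ac_disc + Q * euler_b ac_disc + R * euler_c ac_disc) * ac_words"
    unfolding v_def using inverse_square_root_derivative(4-6) by algebra
  then have "2 * ac_disc * (v ac_words + \<gamma> * ac_words) = 0"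
    unfolding assms(3) by (simp add: algebra_simps)
  then have 3: "v ac_words = - \<gamma> * ac_words" using nonzero_factors by (simp add: eq_neg_iff_add_eq_0)
  have "euler_a (P * triples) + euler_b (Q * triples) + euler_c (R * triples) =
      (euler_a P + euler_b Q + euler_c R) * triples + v triples"
    unfolding v_def by (simp add: euler_simps algebra_simps)
  also have "v triples = - (\<alpha> + \<beta> + \<gamma>) * triples"
    unfolding triples_def derivation_mult[OF der] 1 2 3 by (simp add: algebra_simps)
  finally show ?thesis by (simp add: algebra_simps)
qed

definition diag :: "series3 \<Rightarrow> nat \<Rightarrow> rat" where
  "diag f k = f $ k $ k $ k"

lemma diag_linear:
  "diag (f + g) k = diag f k + diag g k"
  "diag (f - g) k = diag f k - diag g k"
  "diag (- f) k = - diag f k"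
  "diag (numeral n * f) k = numeral n * diag f k"
  by (simp_all add: diag_def fps3_numeral_nth)

lemma diag_euler:
  "diag (euler_a f) k = of_nat k * diag f k" "diag (euler_b f) k = of_nat k * diag f k"
  "diag (euler_c f) k = of_nat k * diag f k"
  by (simp_all add: diag_def fps3_nth)

lemma diag_shift:
  "diag (va * vb * vc * f) k = (if k = 0 then 0 else diag f (k - 1))"
  by (simp add: diag_def fps3_nth mult.assoc del: fps_mult_nth_0)

text \<open>
  Every tangent field gives a recurrence, because the three Euler operators agree on the diagonal.
\<close>
lemma diag_recurrence:
  assumes "P * euler_a letters_den + Q * euler_b letters_den + R * euler_c letters_den = \<alpha> * letters_den"
  and "P * euler_a ab_disc + Q * euler_b ab_disc + R * euler_c ab_disc = 2 * \<beta> * ab_disc"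
  and "P * euler_a ac_disc + Q * euler_b ac_disc + R * euler_c ac_disc = 2 * \<gamma> * ac_disc"
  shows "of_nat k * diag ((P + Q + R) * triples) k =
    diag ((euler_a P + euler_b Q + euler_c R - \<alpha> - \<beta> - \<gamma>) * triples) k"
proof -
  have "of_nat k * diag ((P + Q + R) * triples) k =
      diag (euler_a (P * triples) + euler_b (Q * triples) + euler_c (R * triples)) k"
    by (simp add: diag_linear diag_euler algebra_simps)
  then show ?thesis
    using tangent_field_divergence[OF assms] by simp
qed

section \<open>Three tangent fields\<close>

text \<open>
  For polynomials \<open>P\<close>, \<open>Q\<close>, \<open>R\<close> of a given degree, tangency is a system of linear equations for
  their coefficients. The fields below are solutions of degrees 2, 3 and 4, each one invariant
  under the exchange of \<open>b\<close> and \<open>c\<close>. They are chosen such that \<open>P + Q + R\<close> and the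
  resulting multiplier involve only \<open>1\<close>, the two polynomials below, and multiples of these by
  \<open>a b c\<close>, which shifts the diagonal.
\<close>

abbreviation "letter_imbalance \<equiv> diag ((vb + vc - 2 * va) * triples)"
abbreviation "pair_imbalance \<equiv> diag ((vb + vc - 2 * (va * vb + va * vc + vb * vc)) * triples)"

text \<open>
  Up to a constant factor, this is the only tangent field of degree at most 2.
\<close>
lemma letter_pair_relation: "of_nat k * (3 * pair_imbalance k - letter_imbalance k) = - pair_imbalance k"
proof -
  let ?e = "va * vb + va * vc + vb * vc"
  let ?P = "2 - 2 * va - vb - vc - 2 * ?e"
  let ?Q = "2 * va + vb + 2 * vc - 1 - 2 * ?e"
  let ?R = "2 * va + 2 * vb + vc - 1 - 2 * ?e"
  have "of_nat k * diag ((?P + ?Q + ?R) * triples) k =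
    diag ((euler_a ?P + euler_b ?Q + euler_c ?R - (vb + vc - 2 * va - 2 * ?e) - (vc - 2 * ?e) - (vb - 2 * ?e)) * triples) k"
    by (rule diag_recurrence) (simp_all only: letters_den_def ab_disc_def ac_disc_def euler_simps, algebra+)
  also have "(?P + ?Q + ?R) * triples = 3 * ((vb + vc - 2 * ?e) * triples) - (vb + vc - 2 * va) * triples"
    by algebra
  also have "(euler_a ?P + euler_b ?Q + euler_c ?R - (vb + vc - 2 * va - 2 * ?e) - (vc - 2 * ?e) - (vb - 2 * ?e)) * triples =
    - ((vb + vc - 2 * ?e) * triples)"
    by (simp only: euler_simps, algebra)
  finally show ?thesis by (simp only: diag_linear)
qed

lemma triples_pair_relation:
  "of_nat k * (2 * diag triples k - 54 * (if k = 0 then 0 else diag triples (k - 1))) =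
    - pair_imbalance k"
proof -
  let ?e = "va * vb + va * vc + vb * vc" and ?z = "va * vb * vc"
  let ?P = "3 * vb + 3 * vc - 2 * vb^2 - 2 * vc^2 - 4 * va * vb - 4 * va * vc - 18 * ?z"
  let ?Q = "1 - 3 * vb + 2 * vb^2 + 4 * va * vc - 18 * ?z"
  let ?R = "1 - 3 * vc + 2 * vc^2 + 4 * va * vb - 18 * ?z"
  let ?al = "2 * vb^2 + 2 * vc^2 - vb - vc - 2 * vb * vc - 4 * va * vc - 4 * va * vb - 18 * ?z"
  let ?be = "2 * vc^2 - vc - 2 * va * vb - 18 * ?z"
  let ?ga = "2 * vb^2 - vb - 2 * va * vc - 18 * ?z"
  have "of_nat k * diag ((?P + ?Q + ?R) * triples) k =
    diag ((euler_a ?P + euler_b ?Q + euler_c ?R - ?al - ?be - ?ga) * triples) k"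
    by (rule diag_recurrence) (simp_all only: letters_den_def ab_disc_def ac_disc_def euler_simps, algebra+)
  also have "(?P + ?Q + ?R) * triples = 2 * triples - 54 * (?z * triples)"
    by algebra
  also have "(euler_a ?P + euler_b ?Q + euler_c ?R - ?al - ?be - ?ga) * triples =
    - ((vb + vc - 2 * ?e) * triples)"
    by (simp only: euler_simps, algebra)
  finally show ?thesis by (simp only: diag_linear diag_shift)
qed

lemma pair_letter_relation:
  "of_nat k * (2 * pair_imbalance k - 18 * (if k = 0 then 0 else letter_imbalance (k - 1))) =
    - pair_imbalance k - 6 * (if k = 0 then 0 else letter_imbalance (k - 1))"
proof -
  let ?e = "va * vb + va * vc + vb * vc" and ?z = "va * vb * vc"
  let ?w = "6 * ?z * (2 * va - vb - vc)"
  let ?P = "2 * vb + 2 * vc - (vb + vc)^2 - 2 * va * vb - 2 * va * vc - 2 * va * vb^2 - 2 * va * vc^2 - 8 * ?z + ?w"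
  let ?Q = "vc - vb + vb^2 - vb * vc + 2 * va * vb - 4 * va * vc + 4 * va * vc^2 - 2 * va * vb^2 + 4 * ?z + ?w"
  let ?R = "vb - vc + vc^2 - vb * vc + 2 * va * vc - 4 * va * vb + 4 * va * vb^2 - 2 * va * vc^2 + 4 * ?z + ?w"
  let ?al = "(vb - vc)^2 - 2 * va * (vb + vc) - 2 * va * (vb - vc)^2 + ?w"
  let ?be = "vc^2 - vb * vc - 2 * va * vb^2 - 2 * va * vc^2 - 2 * ?z + ?w"
  let ?ga = "vb^2 - vb * vc - 2 * va * vb^2 - 2 * va * vc^2 - 2 * ?z + ?w"
  have "of_nat k * diag ((?P + ?Q + ?R) * triples) k =
    diag ((euler_a ?P + euler_b ?Q + euler_c ?R - ?al - ?be - ?ga) * triples) k"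
    by (rule diag_recurrence) (simp_all only: letters_den_def ab_disc_def ac_disc_def euler_simps, algebra+)
  also have "(?P + ?Q + ?R) * triples = 2 * ((vb + vc - 2 * ?e) * triples) - 18 * (?z * ((vb + vc - 2 * va) * triples))"
    by algebra
  also have "(euler_a ?P + euler_b ?Q + euler_c ?R - ?al - ?be - ?ga) * triples =
    - ((vb + vc - 2 * ?e) * triples) - 6 * (?z * ((vb + vc - 2 * va) * triples))"
    by (simp only: euler_simps, algebra)
  finally show ?thesis by (simp only: diag_linear diag_shift)
qed

text \<open>
  Writing \<open>x\<close> and \<open>y\<close> for the letter and pair imbalances, the two relations between them read
  \<open>(2 k + 1) y(k) = (18 k - 6) x(k-1)\<close> and \<open>k x(k) = (3 k + 1) y(k)\<close> for \<open>k \<ge> 1\<close>, so that zeros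
  propagate from \<open>x(k-1)\<close> to \<open>y(k)\<close> and on to \<open>x(k)\<close>.
\<close>
lemma imbalances_eq_0: "letter_imbalance k = 0 \<and> pair_imbalance (Suc k) = 0"
proof (induction k)
  case 0
  have x: "letter_imbalance 0 = 0" by (simp add: diag_def va_def vb_def vc_def)
  then show ?case using pair_letter_relation[of "Suc 0"] by simp
next
  case (Suc k)
  then have x: "letter_imbalance (Suc k) = 0" using letter_pair_relation[of "Suc k"] by simp
  have "(2 * of_nat (Suc (Suc k)) + 1) * pair_imbalance (Suc (Suc k)) = 0"
    using pair_letter_relation[of "Suc (Suc k)"] x by (simp add: algebra_simps)
  then have "pair_imbalance (Suc (Suc k)) = 0"
    by (metis mult_eq_0_iff of_nat_1 of_nat_add of_nat_eq_0_iff of_nat_mult of_nat_numeral add_is_0 one_neq_zero)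
  with x show ?case by simp
qed

lemma diag_triples: "diag triples k = 27 ^ k"
proof (induction k)
  case 0
  show ?case by (simp add: diag_def triples_def ab_words_def ac_words_def words_def fps_mult_nth_0 trinomial_def)
next
  case (Suc k)
  have "of_nat (Suc k) * (2 * diag triples (Suc k) - 54 * diag triples k) = 0"
    using triples_pair_relation[of "Suc k"] imbalances_eq_0[of k] by simp
  with Suc show ?case by (simp del: of_nat_Suc)
qed

text \<open>
  The factor \<open>3\<close> of the theorem: \<open>1 = letters_den + 3 a + (b + c - 2 a)\<close>, and the last summand does
  not contribute to the diagonal.
\<close>
lemma diag_split: "27 ^ k = diag (ab_words * ac_words) k + 3 * diag (va * triples) k"
proof -
  have "triples = ab_words * ac_words + 3 * (va * triples) + (vb + vc - 2 * va) * triples"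
    using letters_den_words unfolding triples_def letters_den_def by algebra
  then have "diag triples k = diag (ab_words * ac_words + 3 * (va * triples) + (vb + vc - 2 * va) * triples) k"
    by simp
  then show ?thesis
    using imbalances_eq_0[of k] by (simp add: diag_linear diag_triples)
qed

section \<open>The two sums as diagonal coefficients\<close>

lemma ab_ac_words_nth:
  "(ab_words * ac_words) $ i $ j $ l =
    (\<Sum>p\<le>i. if p \<le> j \<and> i - p \<le> l then trinomial p p (l - (i - p)) * trinomial (i - p) (i - p) (j - p) else 0)"
proof -
  have "(\<Sum>j'\<le>j. \<Sum>l'\<le>l. ab_words $ p $ j' $ l' * ac_words $ (i - p) $ (j - j') $ (l - l')) =
     (if p \<le> j \<and> i - p \<le> l then trinomial p p (l - (i - p)) * trinomial (i - p) (i - p) (j - p) else 0)"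
    if "p \<le> i" for p
  proof -
    have inner: "(\<Sum>l'\<le>l. trinomial p p l' * ac_words $ (i - p) $ (j - p) $ (l - l')) =
        (if i - p \<le> l then trinomial p p (l - (i - p)) * trinomial (i - p) (i - p) (j - p) else 0)"
    proof -
      have "(\<Sum>l'\<le>l. trinomial p p l' * ac_words $ (i - p) $ (j - p) $ (l - l')) =
          (\<Sum>l'\<le>l. if l' = l - (i - p) then
            (if i - p \<le> l then trinomial p p (l - (i - p)) * trinomial (i - p) (i - p) (j - p) else 0) else 0)"
        by (intro sum.cong) (auto simp: ac_words_def)
      then show ?thesis by simp
    qed
    have "(\<Sum>j'\<le>j. \<Sum>l'\<le>l. ab_words $ p $ j' $ l' * ac_words $ (i - p) $ (j - j') $ (l - l')) =
      (\<Sum>j'\<le>j. if j' = p then \<Sum>l'\<le>l. trinomial p p l' * ac_words $ (i - p) $ (j - p) $ (l - l') else 0)"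
      by (intro sum.cong) (simp_all add: ab_words_def)
    also have "\<dots> = (if p \<le> j \<and> i - p \<le> l then trinomial p p (l - (i - p)) * trinomial (i - p) (i - p) (j - p) else 0)"
      by (simp add: inner)
    finally show ?thesis .
  qed
  then show ?thesis
    unfolding fps3_mult_nth by (intro sum.cong) simp_all
qed

lemma diag_ab_ac_words:
  "diag (ab_words * ac_words) k =
    of_nat (\<Sum>(p, q) | p + q = k. multinomial [p, p, p] * multinomial [q, q, q])"
proof -
  have "diag (ab_words * ac_words) k = (\<Sum>p\<le>k. trinomial p p p * trinomial (k - p) (k - p) (k - p))"
    unfolding diag_def ab_ac_words_nth by (intro sum.cong) simp_all
  also have "\<dots> = (\<Sum>(p, q) | p + q = k. trinomial p p p * trinomial q q q)"
    by (rule sum.reindex_bij_witness[of _ fst "\<lambda>p. (p, k - p)"]) auto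
  finally show ?thesis
    by (simp add: of_nat_multinomial_eq_trinomial split_def)
qed

text \<open>
  Here \<open>(p, p, p'')\<close>, \<open>(q, q', q)\<close> and \<open>(r, r', r'')\<close> count the letters \<open>a\<close>, \<open>b\<close>, \<open>c\<close> of the three
  words.
\<close>
lemma triples_nth:
  "triples $ i $ j $ l =
    (\<Sum>(p, q, r, q', r', p'', r'')
      | p + q + r = i \<and> p + q' + r' = j \<and> p'' + q + r'' = l.
       trinomial p p p'' * trinomial q q q' * trinomial r r' r'')"
proof -
  let ?f = "\<lambda>i' j' l' p. trinomial p p (l' - (i' - p)) * trinomial (i' - p) (i' - p) (j' - p)
    * trinomial (i - i') (j - j') (l - l')"
  let ?S = "{..i} \<times> {..j} \<times> {..l} \<times> {..i}"
  have "triples $ i $ j $ l = (\<Sum>i'\<le>i. \<Sum>j'\<le>j. \<Sum>l'\<le>l. \<Sum>p\<le>i'.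
     (if p \<le> j' \<and> i' - p \<le> l' then ?f i' j' l' p else 0))"
    unfolding triples_def fps3_mult_nth[of "ab_words * ac_words"] ab_ac_words_nth sum_distrib_right
    by (intro sum.cong) (simp_all add: words_def)
  also have "\<dots> = (\<Sum>i'\<le>i. \<Sum>j'\<le>j. \<Sum>l'\<le>l. \<Sum>p\<le>i.
     (if p \<le> i' \<and> p \<le> j' \<and> i' - p \<le> l' then ?f i' j' l' p else 0))"
    by (intro sum.cong refl sum.mono_neutral_cong_left) auto
  also have "\<dots> = (\<Sum>(i', j', l', p)\<in>?S. (if p \<le> i' \<and> p \<le> j' \<and> i' - p \<le> l' then ?f i' j' l' p else 0))"
    by (simp add: sum.cartesian_product)
  also have "\<dots> = (\<Sum>(i', j', l', p)\<in>{(i', j', l', p) \<in> ?S. p \<le> i' \<and> p \<le> j' \<and> i' - p \<le> l'}. ?f i' j' l' p)"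
    by (intro sum.mono_neutral_cong_right) (auto split: if_splits)
  also have "\<dots> = (\<Sum>(p, q, r, q', r', p'', r'')
      | p + q + r = i \<and> p + q' + r' = j \<and> p'' + q + r'' = l.
       trinomial p p p'' * trinomial q q q' * trinomial r r' r'')"
    by (rule sum.reindex_bij_witness[of _
        "\<lambda>(p, q, r, q', r', p'', r''). (p + q, p + q', p'' + q, p)"
        "\<lambda>(i', j', l', p). (p, i' - p, i - i', j' - p, j - j', l' - (i' - p), l - l')"]) auto
  finally show ?thesis .
qed

lemma diag_va_triples:
  assumes "k \<ge> 1"
  shows "diag (va * triples) k =
    of_nat (\<Sum>(p, q, r, q', r', p'', r'')
              | p + q + r = k - 1 \<and> r' + q' = r + q + 1 \<and> p'' + r'' = p + r + 1.
            multinomial [p, p, p''] * multinomial [q, q, q'] * multinomial [r, r', r''])"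
proof -
  \<comment> \<open>The extra letter \<open>a\<close> leaves only \<open>k - 1\<close> letters \<open>a\<close> to the three words.\<close>
  have "{(p, q, r, q', r', p'', r''). p + q + r = k - 1 \<and> p + q' + r' = k \<and> p'' + q + r'' = k} =
    {(p, q, r, q', r', p'', r''). p + q + r = k - 1 \<and> r' + q' = r + q + 1 \<and> p'' + r'' = p + r + 1}"
    using assms by auto
  moreover have "diag (va * triples) k = triples $ (k - 1) $ k $ k"
    using assms by (simp add: diag_def fps3_nth)
  ultimately show ?thesis
    unfolding triples_nth by (simp add: of_nat_multinomial_eq_trinomial split_def)
qed

theorem mainTheorem2:
  fixes k :: nat
  assumes "k \<ge> 1"
  shows "3 ^ (3 * k) =
      (\<Sum>(p, q) | p + q = k. multinomial [p, p, p] * multinomial [q, q, q])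
    + 3 * (\<Sum>(p, q, r, q', r', p'', r'')
              | p + q + r = k - 1 \<and> r' + q' = r + q + 1 \<and> p'' + r'' = p + r + 1.
            multinomial [p, p, p''] * multinomial [q, q, q'] * multinomial [r, r', r''])"
    (is "_ = ?S1 + 3 * ?S2")
proof -
  have "rat_of_nat (3 ^ (3 * k)) = 27 ^ k"
    by (simp add: power_mult)
  also have "\<dots> = rat_of_nat (?S1 + 3 * ?S2)"
    unfolding diag_split diag_ab_ac_words diag_va_triples[OF assms]
    by (simp only: of_nat_add of_nat_mult of_nat_numeral)
  finally show ?thesis
    by (simp only: of_nat_eq_iff)
qed

end
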